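(* Suppose $(A,B)$ is controllable and $(Q^{1/2},A)$ is observable. Consider the LQR problem of minimizing $J_{\mathtt{LQR}}(K)=\|\mathbf{T}_{zw}(K,s)\|_{\mathcal{H}_2}^2$ over $K\in\mathcal{K}$, with $W\succ0$, $Q\succeq0$, $R\succ0$. Then all stabilizing policies $K\in\mathcal{K}$ are non-degenerate with respect to the extended convex lifting $(\mathcal{L}_{\mathtt{LQR}},\mathcal{F}_{\mathtt{LQR}},\{0\},\Phi_{\mathtt{LQR}})$ of $J_{\mathtt{LQR}}$.
   Context: Setting: $A\in\mathbb{R}^{n\times n}$, $B\in\mathbb{R}^{n\times m}$, $B_w\in\mathbb{R}^{n\times n}$, $W=B_wB_w^{\mathsf T}$, $Q\in\mathbb{S}^n$, $R\in\mathbb{S}^m$. The set of stabilizing static policies is $\mathcal{K}=\{K\in\mathbb{R}^{m\times n}\mid \max_i\operatorname{Re}\lambda_i(A+BK)<0\}$. The closed-loop transfer function is $\mathbf{T}_{zw}(K,s)=\begin{bmatrix}Q^{1/2}\\ R^{1/2}K\end{bmatrix}(sI-A-BK)^{-1}B_w$, and $\|\cdot\|_{\mathcal{H}_2}$ is the usual $\mathcal{H}_2$ norm, $\|\mathbf{T}\|_{\mathcal{H}_2}^2=\frac1{2\pi}\int_{-\infty}^\infty\operatorname{tr}(\mathbf{T}(j\omega)^{\mathsf H}\mathbf{T}(j\omega))\,d\omega$. The ECL (extended convex lifting) of $J_{\mathtt{LQR}}$ considered consists of the lifted set $$\mathcal{L}_{\mathtt{LQR}}=\{(K,\gamma,X)\mid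 X\succ0,\ (A+BK)X+X(A+BK)^{\mathsf T}+W=0,\ \gamma\ge\operatorname{tr}((Q+K^{\mathsf T}RK)X)\}$$ (with $K\in\mathbb{R}^{m\times n},\gamma\in\mathbb{R},X\in\mathbb{S}^n$), the convex set $$\mathcal{F}_{\mathtt{LQR}}=\{(\gamma,Y,X)\mid X\succ0,\ AX+BY+XA^{\mathsf T}+Y^{\mathsf T}B^{\mathsf T}+W=0,\ \gamma\ge\operatorname{tr}(QX+X^{-1}Y^{\mathsf T}RY)\},$$ the trivial auxiliary set $\{0\}$, and the $C^2$ diffeomorphism $\Phi_{\mathtt{LQR}}(K,\gamma,X)=(\gamma,KX,X)$ from $\mathcal{L}_{\mathtt{LQR}}$ to $\mathcal{F}_{\mathtt{LQR}}$. Non-degeneracy: $K\in\mathcal{K}$ is non-degenerate with respect to this ECL if $(K,J_{\mathtt{LQR}}(K))\in\pi_{K,\gamma}(\mathcal{L}_{\mathtt{LQR}})$, i.e. if there exists $X$ such that $(K,J_{\mathtt{LQR}}(K),X)\in\mathcal{L}_{\mathtt{LQR}}$. *)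

theory Defs
  imports "HOL-Analysis.Analysis"
begin

section \<open>Matrix notions\<close>

definition symmetric :: "real^'n^'n \<Rightarrow> bool" where
  "symmetric M \<longleftrightarrow> transpose M = M"

definition pos_semidef :: "real^'n^'n \<Rightarrow> bool" where
  "pos_semidef M \<longleftrightarrow> symmetric M \<and> (\<forall>x. 0 \<le> x \<bullet> (M *v x))"

definition pos_def :: "real^'n^'n \<Rightarrow> bool" where
  "pos_def M \<longleftrightarrow> symmetric M \<and> (\<forall>x. x \<noteq> 0 \<longrightarrow> 0 < x \<bullet> (M *v x))"

text \<open>The square root \<open>M^(1/2)\<close>. A positive semidefinite \<open>M\<close> has exactly one
  positive semidefinite square root, so the choice operator is harmless.\<close>

definition mat_sqrt :: "real^'n^'n \<Rightarrow> real^'n^'n" where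
  "mat_sqrt M = (SOME S. pos_semidef S \<and> S ** S = M)"

abbreviation cmat :: "real^'n^'m \<Rightarrow> complex^'n^'m" where
  "cmat \<equiv> map_matrix complex_of_real"

definition conj_transpose :: "complex^'n^'m \<Rightarrow> complex^'m^'n" where
  "conj_transpose M = (\<chi> i j. cnj (M $ j $ i))"

definition vstack :: "'a^'n^'p \<Rightarrow> 'a^'n^'q \<Rightarrow> 'a^'n^('p + 'q)" where
  "vstack M N = (\<chi> i. case i of Inl a \<Rightarrow> M $ a | Inr b \<Rightarrow> N $ b)"

text \<open>All complex eigenvalues of a real matrix; this set is finite and nonempty.\<close>

definition eigenvalues :: "real^'n^'n \<Rightarrow> complex set" where
  "eigenvalues M = {z. \<exists>v. v \<noteq> 0 \<and> cmat M *v v = z *s v}"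


section \<open>Controllability and observability of linear systems\<close>

text \<open>\<open>x\<close> solves \<open>x' = A x + B u\<close> on \<open>[0,T]\<close>, in integrated form so that the input
  need only be Lebesgue integrable.\<close>

definition input_solution ::
  "real^'n^'n \<Rightarrow> real^'m^'n \<Rightarrow> (real \<Rightarrow> real^'m) \<Rightarrow> real \<Rightarrow> (real \<Rightarrow> real^'n) \<Rightarrow> bool" where
  "input_solution A B u T x \<longleftrightarrow>
     u absolutely_integrable_on {0..T} \<and> continuous_on {0..T} x \<and>
     (\<forall>t\<in>{0..T}. ((\<lambda>s. A *v x s + B *v u s) has_integral (x t - x 0)) {0..t})"

definition controllable :: "real^'n^'n \<Rightarrow> real^'m^'n \<Rightarrow> bool" where
  "controllable A B \<longleftrightarrow>
     (\<forall>T>0. \<forall>x0 x1. \<exists>u x. input_solution A B u T x \<and> x 0 = x0 \<and> x T = x1)"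

definition free_solution :: "real^'n^'n \<Rightarrow> real \<Rightarrow> (real \<Rightarrow> real^'n) \<Rightarrow> bool" where
  "free_solution A T x \<longleftrightarrow>
     (\<forall>t\<in>{0..T}. (x has_vector_derivative A *v x t) (at t within {0..T}))"

text \<open>The output \<open>y = C x\<close> on \<open>[0,T]\<close> determines the initial state.\<close>

definition observable :: "real^'n^'p \<Rightarrow> real^'n^'n \<Rightarrow> bool" where
  "observable C A \<longleftrightarrow>
     (\<forall>T>0. \<forall>x x'. free_solution A T x \<and> free_solution A T x' \<and>
        (\<forall>t\<in>{0..T}. C *v x t = C *v x' t) \<longrightarrow> x 0 = x' 0)"


section \<open>The LQR problem\<close>

definition stabilizing :: "real^'n^'n \<Rightarrow> real^'m^'n \<Rightarrow> (real^'n^'m) set" where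
  "stabilizing A B = {K. Max (Re ` eigenvalues (A + B ** K)) < 0}"

text \<open>The diagonal entries of \<open>T\<^sup>H T\<close> are real, so \<open>Re\<close> only adjusts the type. The
  norm is real-valued and meaningful only where the integral is finite, in particular for
  strictly proper stable transfer functions.\<close>

definition h2_norm :: "(complex \<Rightarrow> complex^'n^'p) \<Rightarrow> real" where
  "h2_norm T = sqrt (1 / (2 * pi) *
     (LINT \<omega>|lborel. Re (trace (conj_transpose (T (\<i> * of_real \<omega>)) ** T (\<i> * of_real \<omega>)))))"

definition transfer_zw ::
  "real^'n^'n \<Rightarrow> real^'m^'n \<Rightarrow> real^'n^'n \<Rightarrow> real^'n^'n \<Rightarrow> real^'m^'m \<Rightarrow>
   real^'n^'m \<Rightarrow> complex \<Rightarrow> complex^'n^('n + 'm)" where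
  "transfer_zw A B Bw Q R K s =
     cmat (vstack (mat_sqrt Q) (mat_sqrt R ** K)) **
     matrix_inv (mat s - cmat A - cmat (B ** K)) ** cmat Bw"

definition J_LQR ::
  "real^'n^'n \<Rightarrow> real^'m^'n \<Rightarrow> real^'n^'n \<Rightarrow> real^'n^'n \<Rightarrow> real^'m^'m \<Rightarrow> real^'n^'m \<Rightarrow> real" where
  "J_LQR A B Bw Q R K = (h2_norm (transfer_zw A B Bw Q R K))\<^sup>2"


section \<open>The extended convex lifting\<close>

definition L_LQR ::
  "real^'n^'n \<Rightarrow> real^'m^'n \<Rightarrow> real^'n^'n \<Rightarrow> real^'n^'n \<Rightarrow> real^'m^'m \<Rightarrow>
   ((real^'n^'m) \<times> real \<times> (real^'n^'n)) set" where
  "L_LQR A B W Q R = {(K, \<gamma>, X). pos_def X \<and>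
     (A + B ** K) ** X + X ** transpose (A + B ** K) + W = 0 \<and>
     \<gamma> \<ge> trace ((Q + transpose K ** R ** K) ** X)}"

definition F_LQR ::
  "real^'n^'n \<Rightarrow> real^'m^'n \<Rightarrow> real^'n^'n \<Rightarrow> real^'n^'n \<Rightarrow> real^'m^'m \<Rightarrow>
   (real \<times> (real^'n^'m) \<times> (real^'n^'n)) set" where
  "F_LQR A B W Q R = {(\<gamma>, Y, X). pos_def X \<and>
     A ** X + B ** Y + X ** transpose A + transpose Y ** transpose B + W = 0 \<and>
     \<gamma> \<ge> trace (Q ** X + matrix_inv X ** transpose Y ** R ** Y)}"

definition Phi_LQR ::
  "(real^'n^'m) \<times> real \<times> (real^'n^'n) \<Rightarrow> real \<times> (real^'n^'m) \<times> (real^'n^'n)" where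
  "Phi_LQR = (\<lambda>(K, \<gamma>, X). (\<gamma>, K ** X, X))"

text \<open>The data of an extended convex lifting: lifted set, convex set, auxiliary set, and the
  map \<open>\<Phi>\<close>. For the trivial auxiliary set \<open>{0}\<close> the product \<open>F \<times> {0}\<close> is identified
  with \<open>F\<close>, so \<open>\<Phi>\<close> takes values in the ambient space of \<open>F\<close>.\<close>

type_synonym ('k, 'x, 'f) ecl =
  "('k \<times> real \<times> 'x) set \<times> 'f set \<times> real set \<times> ('k \<times> real \<times> 'x \<Rightarrow> 'f)"

definition ecl_LQR ::
  "real^'n^'n \<Rightarrow> real^'m^'n \<Rightarrow> real^'n^'n \<Rightarrow> real^'n^'n \<Rightarrow> real^'m^'m \<Rightarrow>
   (real^'n^'m, real^'n^'n, real \<times> (real^'n^'m) \<times> (real^'n^'n)) ecl" where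
  "ecl_LQR A B W Q R = (L_LQR A B W Q R, F_LQR A B W Q R, {0}, Phi_LQR)"

definition non_degenerate :: "('k, 'x, 'f) ecl \<Rightarrow> ('k \<Rightarrow> real) \<Rightarrow> 'k \<Rightarrow> bool" where
  "non_degenerate E J K \<longleftrightarrow>
     (case E of (L, F, G, \<Phi>) \<Rightarrow> (K, J K) \<in> (\<lambda>(k, \<gamma>, x). (k, \<gamma>)) ` L)"

end

theory Submission
  imports Defs "HOL-Complex_Analysis.Cauchy_Integral_Theorem"
begin

text \<open>
  Fix a stabilizing \<open>K\<close> and put \<open>M = A + B K\<close>, a matrix with spectrum in the open left half
  plane. It suffices to find a positive definite solution \<open>X\<close> of the Lyapunov equation
  \<open>M X + X M\<^sup>T + W = 0\<close> with \<open>J(K) = tr ((Q + K\<^sup>T R K) X)\<close>.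

  Everything is done in the frequency domain, without the matrix exponential. Let
  \<open>F(s) = (s I - M)\<^sup>-\<^sup>1\<close>. If \<open>X\<close> solves the Lyapunov equation, then
  \<open>F W F\<^sup>H = X F\<^sup>H + F X\<close> on the imaginary axis (\<open>resolvent_lyapunov\<close>). The right-hand side is
  linear in \<open>F\<close>, and the principal value of \<open>\<integral> F(\<i>\<omega>) d\<omega>\<close> is \<open>\<pi> I\<close>
  (\<open>has_pv_integral_resolvent\<close>): \<open>F\<close> is holomorphic on a half plane that contains the closed
  right half plane, and \<open>s F(s)\<close> tends to \<open>I\<close> at infinity, so the integral can be moved to a
  large half circle. Hence the principal value of \<open>\<integral> F W F\<^sup>H d\<omega>\<close> is \<open>2 \<pi> X\<close>
  (\<open>has_pv_integral_lyapunov\<close>).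

  This single formula has three consequences. For \<open>W = 0\<close> it shows that the Lyapunov operator
  is injective, hence bijective, so that \<open>X\<close> exists and is unique. For the quadratic form of
  \<open>X\<close> it shows that \<open>X\<close> is positive semidefinite; as \<open>W\<close> is positive definite, so is \<open>X\<close>.
  Contracted with \<open>C\<^sup>T C = Q + K\<^sup>T R K\<close>, where \<open>C\<close> stacks \<open>Q\<^sup>1\<^sup>/\<^sup>2\<close> and
  \<open>R\<^sup>1\<^sup>/\<^sup>2 K\<close>, it is the formula for \<open>J(K)\<close> (\<open>h2_norm_squared\<close>). The identity for
  \<open>C\<^sup>T C\<close> requires that positive semidefinite matrices have positive semidefinite square roots,
  which follows from the spectral theorem for real symmetric matrices.
\<close>

section \<open>Square roots of positive semidefinite matrices\<close>

lemma symmetric_inner_matrix_vector: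
  fixes M :: "real^'n^'n"
  assumes "symmetric M"
  shows "x \<bullet> (M *v y) = y \<bullet> (M *v x)"
proof -
  have "x \<bullet> (M *v y) = (x v* M) \<bullet> y"
    by (simp add: dot_lmul_matrix)
  also have "x v* M = M *v x"
    using assms by (metis symmetric_def transpose_matrix_vector)
  finally show ?thesis
    by (simp add: inner_commute)
qed

text \<open>A maximiser \<open>v\<close> of the Rayleigh quotient on the unit sphere of \<open>S\<close> is an eigenvector:
  perturbing it in the direction of the residual \<open>w = M v - l v\<close>, which is orthogonal to
  \<open>v\<close>, would otherwise increase the quotient to first order.\<close>

lemma symmetric_eigenvector_in_invariant_subspace:
  fixes M :: "real^'n^'n"
  assumes sym: "symmetric M" and S: "subspace S" "S \<noteq> {0}"
    and inv: "\<And>x. x \<in> S \<Longrightarrow> M *v x \<in> S"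
  obtains v l where "v \<in> S" "norm v = 1" "M *v v = l *\<^sub>R v"
proof -
  let ?q = "\<lambda>x. x \<bullet> (M *v x)"
  have "compact (sphere 0 1 \<inter> S)"
    by (simp add: S closed_subspace compact_Int_closed)
  moreover obtain x0 where x0: "x0 \<in> S" "x0 \<noteq> 0"
    using S subspace_0 by blast
  then have "x0 /\<^sub>R norm x0 \<in> sphere 0 1 \<inter> S"
    using S by (simp add: subspace_scale)
  then have "sphere 0 1 \<inter> S \<noteq> {}"
    by blast
  moreover have "continuous_on (sphere 0 1 \<inter> S) ?q"
    by (intro continuous_intros linear_continuous_on matrix_vector_mul_bounded_linear)
  ultimately have "\<exists>v\<in>sphere 0 1 \<inter> S. \<forall>y\<in>sphere 0 1 \<inter> S. ?q y \<le> ?q v"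
    by (rule continuous_attains_sup)
  then obtain v where v: "v \<in> S" "norm v = 1"
      and max: "\<And>y. y \<in> S \<Longrightarrow> norm y = 1 \<Longrightarrow> ?q y \<le> ?q v"
    by auto
  define l where "l = ?q v"
  have le: "?q y \<le> l * (y \<bullet> y)" if "y \<in> S" for y
  proof (cases "y = 0")
    case False
    have "?q (y /\<^sub>R norm y) \<le> l"
      unfolding l_def using max[of "y /\<^sub>R norm y"] that False S by (simp add: subspace_scale)
    then have "?q y / (norm y)\<^sup>2 \<le> l"
      by (simp add: matrix_vector_mult_scaleR power2_eq_square divide_inverse mult_ac)
    then show ?thesis
      using False by (simp add: field_simps power2_norm_eq_inner)
  qed simp
  define w where "w = M *v v - l *\<^sub>R v"
  have wS: "w \<in> S"
    unfolding w_def using v inv S by (simp add: subspace_diff subspace_scale)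
  have vv: "v \<bullet> v = 1"
    using v(2) by (simp add: norm_eq_1)
  have vw: "v \<bullet> w = 0"
    by (simp add: w_def inner_diff_right vv l_def)
  have wMv: "w \<bullet> (M *v v) = w \<bullet> w"
  proof -
    have "M *v v = w + l *\<^sub>R v"
      by (simp add: w_def)
    then show ?thesis
      using vw by (simp add: inner_add_right inner_commute)
  qed
  define c where "c = l * (w \<bullet> w) - ?q w"
  \<comment> \<open>The maximality of \<open>v\<close>, tested at \<open>v + t w\<close> and divided by \<open>t\<close>.\<close>
  have small: "2 * (w \<bullet> w) \<le> t * c" if "t > 0" for t
  proof -
    have "v + t *\<^sub>R w \<in> S"
      using v wS S by (simp add: subspace_add subspace_scale)
    from le[OF this]
    have "l + 2 * t * (w \<bullet> w) + t * t * ?q w \<le> l * (1 + t * t * (w \<bullet> w))"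
      using symmetric_inner_matrix_vector[OF sym, of v w] wMv
      by (simp add: vv vw inner_commute[of w v] l_def[symmetric] algebra_simps)
    then have "t * (2 * (w \<bullet> w)) \<le> t * (t * c)"
      by (simp add: c_def algebra_simps)
    then show ?thesis
      using that by simp
  qed
  have "((\<lambda>t. t * c) \<longlongrightarrow> 0 * c) (at_right 0)"
    by (intro tendsto_intros)
  moreover have "\<forall>\<^sub>F t in at_right 0. 2 * (w \<bullet> w) \<le> t * c"
    using small by (auto simp: eventually_at_filter)
  ultimately have "2 * (w \<bullet> w) \<le> 0 * c"
    by (intro tendsto_lowerbound) auto
  then have "w = 0"
    by (simp add: power2_norm_eq_inner[symmetric])
  then show thesis
    using that[of v l] v by (simp add: w_def)
qed

text \<open>The spectral theorem, by induction on the dimension of an invariant subspace: the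
  orthogonal complement of an eigenvector in an invariant subspace is again invariant.\<close>

lemma symmetric_orthonormal_eigenbasis:
  fixes M :: "real^'n^'n"
  assumes sym: "symmetric M" and "subspace S" "\<And>x. x \<in> S \<Longrightarrow> M *v x \<in> S"
  shows "\<exists>B. finite B \<and> pairwise orthogonal B \<and> span B = S \<and>
           (\<forall>v\<in>B. norm v = 1 \<and> (\<exists>l. M *v v = l *\<^sub>R v))"
  using assms(2,3)
proof (induction "dim S" arbitrary: S rule: less_induct)
  case less
  show ?case
  proof (cases "S = {0}")
    case True
    then show ?thesis
      by (intro exI[of _ "{}"]) auto
  next
    case False
    obtain v l where v: "v \<in> S" "norm v = 1" "M *v v = l *\<^sub>R v"
      using symmetric_eigenvector_in_invariant_subspace[OF sym less.prems(1) False less.prems(2)]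
      by metis
    have vv: "v \<bullet> v = 1"
      using v(2) by (simp add: norm_eq_1)
    define S' where "S' = {x \<in> S. v \<bullet> x = 0}"
    have sub: "subspace S'"
      using less.prems(1) by (auto simp: S'_def subspace_def inner_add_right)
    have inv: "M *v x \<in> S'" if "x \<in> S'" for x
      using that less.prems(2) symmetric_inner_matrix_vector[OF sym, of v x] v(3)
      by (auto simp: S'_def inner_commute)
    have "S' \<subseteq> S" "v \<notin> S'"
      by (auto simp: S'_def vv)
    then have "dim S' < dim S"
      using sub less.prems(1) v(1) by (metis dim_subset le_neq_implies_less subspace_dim_equal)
    from less.hyps[OF this sub inv] obtain B where B: "finite B" "pairwise orthogonal B" "span B = S'"
        "\<And>x. x \<in> B \<Longrightarrow> norm x = 1 \<and> (\<exists>l. M *v x = l *\<^sub>R x)"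
      by blast
    have "pairwise orthogonal (insert v B)"
      unfolding pairwise_insert
    proof (intro conjI allI impI)
      fix y assume "y \<in> B \<and> y \<noteq> v"
      then have "y \<in> S'"
        using B(3) span_base by blast
      then show "orthogonal v y" "orthogonal y v"
        by (auto simp: S'_def orthogonal_def inner_commute)
    qed (use B in auto)
    moreover have "span (insert v B) = S"
    proof
      have "insert v B \<subseteq> S"
        using v(1) \<open>S' \<subseteq> S\<close> B(3) span_base by blast
      then show "span (insert v B) \<subseteq> S"
        using less.prems(1) by (simp add: span_minimal)
      show "S \<subseteq> span (insert v B)"
      proof
        fix x assume "x \<in> S"
        then have "x - (v \<bullet> x) *\<^sub>R v \<in> S'"
          using v(1) less.prems(1) by (simp add: S'_def vv inner_diff_right subspace_diff subspace_scale)
        then show "x \<in> span (insert v B)"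
          using B(3) by (auto simp: span_insert)
      qed
    qed
    ultimately show ?thesis
      using B v by (intro exI[of _ "insert v B"]) auto
  qed
qed

lemma pos_semidef_square_root_exists:
  fixes M :: "real^'n^'n"
  assumes "pos_semidef M"
  shows "\<exists>S. pos_semidef S \<and> S ** S = M"
proof -
  have sym: "symmetric M" and nn: "\<And>x. 0 \<le> x \<bullet> (M *v x)"
    using assms by (auto simp: pos_semidef_def)
  have "\<exists>B. finite B \<and> pairwise orthogonal B \<and> span B = UNIV \<and>
      (\<forall>v\<in>B. norm v = 1 \<and> (\<exists>l. M *v v = l *\<^sub>R v))"
    by (rule symmetric_orthonormal_eigenbasis[OF sym subspace_UNIV]) simp
  then obtain B where B: "finite B" "pairwise orthogonal B" "span B = UNIV"
      "\<And>v. v \<in> B \<Longrightarrow> norm v = 1" "\<forall>v\<in>B. \<exists>l. M *v v = l *\<^sub>R v"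
    by auto
  obtain l where l: "\<And>v. v \<in> B \<Longrightarrow> M *v v = l v *\<^sub>R v"
    using bchoice[OF B(5)] by blast
  have one: "v \<bullet> v = 1" if "v \<in> B" for v
    using B(4)[OF that] by (simp add: norm_eq_1)
  have l_nn: "0 \<le> l v" if "v \<in> B" for v
    using nn[of v] l[OF that] one[OF that] by simp
  have ortho: "v \<bullet> w = (if v = w then 1 else 0)" if "v \<in> B" "w \<in> B" for v w
    using that one B(2) by (auto simp: pairwise_def orthogonal_def)
  have expand: "(\<Sum>v\<in>B. (x \<bullet> v) *\<^sub>R v) = x" for x
    using orthonormal_basis_expand[OF B(2,4) _ B(1)] B(3) by auto
  define f where "f x = (\<Sum>v\<in>B. (sqrt (l v) * (x \<bullet> v)) *\<^sub>R v)" for x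
  have lin: "linear f"
    by (rule linearI) (simp_all add: f_def algebra_simps sum.distrib scaleR_sum_right)
  have f_B: "f v = sqrt (l v) *\<^sub>R v" if "v \<in> B" for v
  proof -
    have "f v = (\<Sum>w\<in>B. if w = v then sqrt (l v) *\<^sub>R v else 0)"
      unfolding f_def using that by (intro sum.cong) (auto simp: ortho)
    then show ?thesis
      using that B(1) by simp
  qed
  have mf: "matrix f *v x = f x" for x
    using lin by (simp add: matrix_works linear_matrix_vector_mul_eq)
  have inner_f: "x \<bullet> f y = (\<Sum>v\<in>B. sqrt (l v) * (x \<bullet> v) * (y \<bullet> v))" for x y
    by (simp add: f_def inner_sum_right mult_ac)
  have "f (f x) = M *v x" for x
  proof -
    have "f (f x) = (\<Sum>v\<in>B. (sqrt (l v) * (x \<bullet> v)) *\<^sub>R f v)"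
      by (subst (2) f_def) (simp add: linear_sum[OF lin] linear_scale[OF lin])
    also have "\<dots> = (\<Sum>v\<in>B. (x \<bullet> v) *\<^sub>R (M *v v))"
      by (intro sum.cong) (auto simp: f_B l l_nn mult_ac)
    also have "\<dots> = M *v (\<Sum>v\<in>B. (x \<bullet> v) *\<^sub>R v)"
      by (simp add: linear_sum[OF matrix_vector_mul_linear] matrix_vector_mult_scaleR)
    finally show ?thesis
      by (simp add: expand)
  qed
  then have "matrix f ** matrix f = M"
    by (simp add: matrix_eq matrix_vector_mul_assoc[symmetric] mf)
  moreover have "pos_semidef (matrix f)"
    unfolding pos_semidef_def symmetric_def
  proof
    have "adjoint f = f"
      by (rule adjoint_unique) (simp add: inner_f inner_commute[of "f _"] mult_ac)
    then show "transpose (matrix f) = matrix f"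
      by (metis lin matrix_adjoint)
    show "\<forall>x. 0 \<le> x \<bullet> (matrix f *v x)"
      by (auto simp: mf inner_f mult.assoc intro!: sum_nonneg mult_nonneg_nonneg[OF _ zero_le_square] l_nn)
  qed
  ultimately show ?thesis
    by blast
qed

lemma mat_sqrt_properties:
  assumes "pos_semidef M"
  shows "transpose (mat_sqrt M) = mat_sqrt M" "mat_sqrt M ** mat_sqrt M = M"
proof -
  have "pos_semidef (mat_sqrt M) \<and> mat_sqrt M ** mat_sqrt M = M"
    unfolding mat_sqrt_def by (rule someI_ex[OF pos_semidef_square_root_exists[OF assms]])
  then show "transpose (mat_sqrt M) = mat_sqrt M" "mat_sqrt M ** mat_sqrt M = M"
    by (auto simp: pos_semidef_def symmetric_def)
qed

section \<open>The resolvent of a real matrix\<close>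

text \<open>The resolvent \<open>(s I - M)\<^sup>-\<^sup>1\<close>. It is meaningful only off the spectrum of \<open>M\<close>; at an
  eigenvalue \<open>matrix_inv\<close> returns an unspecified matrix.\<close>

definition resolvent :: "real^'n^'n \<Rightarrow> complex \<Rightarrow> complex^'n^'n" where
  "resolvent M s = matrix_inv (mat s - cmat M)"

lemma mat_mult_vec: "mat s *v (v :: complex^'n) = s *s v"
  by (simp add: vec_eq_iff matrix_vector_mult_def mat_def if_distrib if_distribR cong: if_cong)

lemma char_matrix_mult_vec:
  fixes M :: "real^'n^'n"
  shows "(mat s - cmat M) *v v = s *s v - cmat M *v v"
  by (simp add: matrix_vector_mult_diff_rdistrib mat_mult_vec)

lemma invertible_char_matrix:
  assumes "s \<notin> eigenvalues M"
  shows "invertible (mat s - cmat M)"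
proof -
  have "\<forall>v. (mat s - cmat M) *v v = 0 \<longrightarrow> v = 0"
    using assms by (auto simp: char_matrix_mult_vec eigenvalues_def)
  then show ?thesis
    by (simp add: invertible_left_inverse matrix_left_invertible_ker)
qed

lemma resolvent_inverse:
  assumes "s \<notin> eigenvalues M"
  shows "(mat s - cmat M) ** resolvent M s = mat 1" "resolvent M s ** (mat s - cmat M) = mat 1"
proof -
  have "\<exists>N. (mat s - cmat M) ** N = mat 1 \<and> N ** (mat s - cmat M) = mat 1"
    using invertible_char_matrix[OF assms] by (simp add: invertible_def)
  from someI_ex[OF this]
  show "(mat s - cmat M) ** resolvent M s = mat 1" "resolvent M s ** (mat s - cmat M) = mat 1"
    by (auto simp: resolvent_def matrix_inv_def)
qed

lemma norm_scalar_mult_vec: "norm (s *s (v :: complex^'n)) = norm s * norm v"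
  by (simp add: norm_vec_def norm_mult L2_set_right_distrib)

lemma matrix_vector_bound:
  fixes M :: "complex^'n^'m"
  obtains K where "0 < K" "\<And>v. norm (M *v v) \<le> K * norm v"
  using bounded_linear.pos_bounded[OF matrix_vector_mul_bounded_linear[of M]]
  by (auto simp: mult.commute)

text \<open>The eigenvalues are roots of the characteristic polynomial, which is nonzero because the
  modulus of an eigenvalue is at most the operator norm of \<open>M\<close>.\<close>

lemma finite_eigenvalues:
  fixes M :: "real^'n^'n"
  shows "finite (eigenvalues M)"
proof -
  \<comment> \<open>The characteristic polynomial, as the Leibniz expansion of \<open>det (s I - M)\<close> in \<open>s\<close>.\<close>
  define p :: "complex poly" where
    "p = (\<Sum>q | q permutes (UNIV :: 'n set). of_int (sign q) *
       (\<Prod>i\<in>UNIV. if i = q i then [:- of_real (M $ i $ q i), 1:] else [:- of_real (M $ i $ q i):]))"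
  have p: "poly p s = det (mat s - cmat M)" for s
    unfolding p_def det_def poly_sum poly_mult poly_prod
    by (intro sum.cong arg_cong2[where f = "(*)"] prod.cong) (auto simp: mat_def of_int_poly)
  obtain K where K: "0 < K" "\<And>v. norm (cmat M *v v) \<le> K * norm v"
    using matrix_vector_bound by blast
  have bound: "norm z \<le> K" if "z \<in> eigenvalues M" for z
  proof -
    obtain v where v: "v \<noteq> 0" "cmat M *v v = z *s v"
      using \<open>z \<in> eigenvalues M\<close> by (auto simp: eigenvalues_def)
    then show ?thesis
      using K(2)[of v] by (simp add: norm_scalar_mult_vec)
  qed
  have "of_real (K + 1) \<notin> eigenvalues M"
    using bound[of "of_real (K + 1)"] K(1) by auto
  then have "poly p (of_real (K + 1)) \<noteq> 0"
    using invertible_char_matrix[of "of_real (K + 1)" M] by (simp add: p invertible_det_nz)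
  then have "p \<noteq> 0"
    by auto
  moreover have "eigenvalues M \<subseteq> {s. poly p s = 0}"
  proof
    fix z assume "z \<in> eigenvalues M"
    then obtain v where v: "v \<noteq> 0" "cmat M *v v = z *s v"
      by (auto simp: eigenvalues_def)
    then have "(mat z - cmat M) *v v = 0"
      by (simp add: char_matrix_mult_vec)
    then have "\<not> invertible (mat z - cmat M)"
      using v(1) by (auto simp: invertible_left_inverse matrix_left_invertible_ker)
    then show "z \<in> {s. poly p s = 0}"
      by (simp add: p invertible_det_nz)
  qed
  ultimately show ?thesis
    using poly_roots_finite finite_subset by blast
qed

text \<open>Cramer's rule, applied to the \<open>j\<close>-th column of the resolvent. It makes the entries of
  the resolvent quotients of polynomials in \<open>s\<close>.\<close>

lemma resolvent_entry:
  fixes M :: "real^'n^'n"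
  assumes "s \<notin> eigenvalues M"
  shows "resolvent M s $ i $ j =
    det (\<chi> a b. if b = i then axis j 1 $ a else (mat s - cmat M) $ a $ b) / det (mat s - cmat M)"
proof -
  let ?c = "resolvent M s *v axis j 1"
  have "(mat s - cmat M) *v ?c = axis j 1"
    by (simp add: matrix_vector_mul_assoc resolvent_inverse[OF assms])
  moreover have "det (mat s - cmat M) \<noteq> 0"
    using invertible_char_matrix[OF assms] by (simp add: invertible_det_nz)
  ultimately have "?c = (\<chi> i. det (\<chi> a b. if b = i then axis j 1 $ a
      else (mat s - cmat M) $ a $ b) / det (mat s - cmat M))"
    by (rule iffD1[OF cramer, rotated])
  moreover have "?c $ i = resolvent M s $ i $ j"
    by (simp add: matrix_vector_mul_component matrix_vector_mult_def axis_def if_distrib cong: if_cong)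
  ultimately show ?thesis
    by simp
qed

lemma holomorphic_on_det:
  fixes G :: "complex \<Rightarrow> complex^'n^'n"
  assumes "\<And>i j. (\<lambda>s. G s $ i $ j) holomorphic_on S"
  shows "(\<lambda>s. det (G s)) holomorphic_on S"
  unfolding det_def by (intro holomorphic_intros assms)

lemma holomorphic_on_resolvent:
  fixes M :: "real^'n^'n"
  shows "(\<lambda>s. resolvent M s $ i $ j) holomorphic_on - eigenvalues M"
proof -
  have entry: "(\<lambda>s. (mat s - cmat M) $ a $ b) holomorphic_on - eigenvalues M" for a b
    by (cases "a = b") (simp_all add: mat_def, (intro holomorphic_intros)+)
  have "(\<lambda>s. if b = i then axis j 1 $ a else (mat s - cmat M) $ a $ b) holomorphic_on - eigenvalues M" for a b
    using entry[of a b] by (cases "b = i") (auto intro: holomorphic_intros)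
  then have "(\<lambda>s. det (\<chi> a b. if b = i then axis j 1 $ a else (mat s - cmat M) $ a $ b) /
      det (mat s - cmat M)) holomorphic_on - eigenvalues M"
    using invertible_char_matrix[of _ M]
    by (intro holomorphic_on_divide holomorphic_on_det entry) (auto simp: invertible_det_nz)
  then show ?thesis
    by (rule holomorphic_transform) (simp add: resolvent_entry)
qed

text \<open>The columns \<open>c\<close> of the resolvent satisfy \<open>s c = e\<^sub>j + M c\<close>, so \<open>c = O(1 / s)\<close> and
  \<open>s c\<close> tends to \<open>e\<^sub>j\<close>.\<close>

lemma resolvent_at_infinity:
  fixes M :: "real^'n^'n"
  shows "((\<lambda>s. s * resolvent M s $ i $ j) \<longlongrightarrow> (if i = j then 1 else 0)) at_infinity"
proof -
  obtain K where K: "0 < K" "\<And>v. norm (cmat M *v v) \<le> K * norm v"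
    using matrix_vector_bound by blast
  have "norm (s * resolvent M s $ i $ j - (if i = j then 1 else 0)) \<le> K / (norm s - K)"
    if s: "norm s > K" for s
  proof -
    have "s \<notin> eigenvalues M"
    proof
      assume "s \<in> eigenvalues M"
      then obtain v where v: "v \<noteq> 0" "cmat M *v v = s *s v"
        by (auto simp: eigenvalues_def)
      then show False
        using K(2)[of v] s by (simp add: norm_scalar_mult_vec)
    qed
    define c where "c = resolvent M s *v axis j 1"
    have "(mat s - cmat M) *v c = axis j 1"
      using \<open>s \<notin> eigenvalues M\<close> by (simp add: c_def matrix_vector_mul_assoc resolvent_inverse)
    then have c: "s *s c = axis j 1 + cmat M *v c"
      by (simp add: char_matrix_mult_vec diff_eq_eq)
    have ci: "c $ i = resolvent M s $ i $ j"
      by (simp add: c_def matrix_vector_mult_def axis_def if_distrib cong: if_cong)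
    have "norm s * norm c \<le> norm (axis j 1 :: complex^'n) + norm (cmat M *v c)"
      unfolding norm_scalar_mult_vec[symmetric] c by (rule norm_triangle_ineq)
    also have "\<dots> \<le> 1 + K * norm c"
      using K(2)[of c] by (simp add: norm_eq_sqrt_inner inner_axis_axis)
    finally have "norm c \<le> 1 / (norm s - K)"
      using s by (simp add: field_simps)
    have "s * c $ i = (if i = j then 1 else 0) + (cmat M *v c) $ i"
      using arg_cong[OF c, of "\<lambda>v. v $ i"] by (simp add: axis_def)
    then have "norm (s * resolvent M s $ i $ j - (if i = j then 1 else 0)) = norm ((cmat M *v c) $ i)"
      by (simp add: ci)
    also have "\<dots> \<le> norm (cmat M *v c)"
      by (rule Finite_Cartesian_Product.norm_nth_le)
    also have "\<dots> \<le> K * (1 / (norm s - K))"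
      using K(2)[of c] \<open>norm c \<le> _\<close> K(1) by (meson less_imp_le mult_left_mono order_trans)
    finally show ?thesis
      by simp
  qed
  then have "\<forall>\<^sub>F s in at_infinity.
      norm (s * resolvent M s $ i $ j - (if i = j then 1 else 0)) \<le> K / (norm s - K)"
    by (intro eventually_at_infinityI[of "K + 1"]) simp
  moreover have "((\<lambda>s::complex. K / (norm s - K)) \<longlongrightarrow> 0) at_infinity"
    by (intro tendsto_divide_0[OF tendsto_const] filterlim_at_top_imp_at_infinity
        filterlim_tendsto_add_at_top[where f = "\<lambda>_. - K" and c = "- K", simplified]
        filterlim_norm_at_top)
  ultimately have "((\<lambda>s. s * resolvent M s $ i $ j - (if i = j then 1 else 0)) \<longlongrightarrow> 0) at_infinity"
    by (rule Lim_null_comparison)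
  then show ?thesis
    by (simp add: LIM_zero_iff)
qed

section \<open>Principal values of integrals over the real line\<close>

text \<open>The integral of \<open>f\<close> over the real line exists as the limit of the integrals over
  symmetric intervals. This is weaker than integrability: entries of the resolvent decay
  only like \<open>1 / \<omega>\<close> along the imaginary axis.\<close>

definition has_pv_integral :: "(real \<Rightarrow> 'a::euclidean_space) \<Rightarrow> 'a \<Rightarrow> bool" where
  "has_pv_integral f c \<longleftrightarrow> (\<forall>r. f integrable_on {-r..r}) \<and>
     ((\<lambda>r. integral {-r..r} f) \<longlongrightarrow> c) at_top"

lemma has_pv_integral_linear:
  assumes "has_pv_integral f c" "bounded_linear h"
  shows "has_pv_integral (\<lambda>x. h (f x)) (h c)"
  using assms integrable_linear[of f _ h] integral_linear[of f _ h] bounded_linear.tendsto[of h]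
  by (auto simp: has_pv_integral_def o_def)

lemma has_pv_integral_add:
  "has_pv_integral f c \<Longrightarrow> has_pv_integral g d \<Longrightarrow> has_pv_integral (\<lambda>x. f x + g x) (c + d)"
  by (auto simp: has_pv_integral_def integral_add intro!: integrable_add tendsto_add)

lemma has_pv_integral_0: "has_pv_integral (\<lambda>x. 0) 0"
  by (simp add: has_pv_integral_def integrable_0)

lemma has_pv_integral_sum:
  "(\<And>i. i \<in> I \<Longrightarrow> has_pv_integral (f i) (c i)) \<Longrightarrow>
    has_pv_integral (\<lambda>x. \<Sum>i\<in>I. f i x) (\<Sum>i\<in>I. c i)"
  by (induction I rule: infinite_finite_induct)
    (auto intro: has_pv_integral_add has_pv_integral_0)

lemma has_pv_integral_unique: "has_pv_integral f c \<Longrightarrow> has_pv_integral f d \<Longrightarrow> c = d"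
  using tendsto_unique[OF trivial_limit_at_top_linorder] by (auto simp: has_pv_integral_def)

lemma has_pv_integral_nonneg:
  fixes f :: "real \<Rightarrow> real"
  assumes "has_pv_integral f c" "\<And>x. 0 \<le> f x"
  shows "0 \<le> c"
  by (rule tendsto_lowerbound[of "\<lambda>r. integral {-r..r} f" _ at_top])
    (use assms in \<open>auto simp: has_pv_integral_def intro!: always_eventually integral_nonneg\<close>)

text \<open>For nonnegative functions, the principal value is the Lebesgue integral, by monotone
  convergence.\<close>

lemma lebesgue_integral_eq_pv_integral:
  fixes f :: "real \<Rightarrow> real"
  assumes pv: "has_pv_integral f c" and nonneg: "\<And>x. 0 \<le> f x" and cont: "continuous_on UNIV f"
  shows "(LINT x|lborel. f x) = c"
proof -
  let ?g = "\<lambda>n::nat. \<lambda>x. indicator {-real n..real n} x *\<^sub>R f x"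
  have int: "integrable lborel (?g n)" for n
    using borel_integrable_compact[of "{-real n..real n}" f] continuous_on_subset[OF cont]
    by simp
  show ?thesis
  proof (rule integral_monotone_convergence_nonneg(2)[of lborel ?g])
    show "AE x in lborel. mono (\<lambda>n. ?g n x)"
      using nonneg by (auto simp: mono_def split: split_indicator)
    show "AE x in lborel. (\<lambda>n. ?g n x) \<longlonglongrightarrow> f x"
    proof (rule AE_I2)
      fix x
      have "?g n x = f x" if "n \<ge> nat \<lceil>\<bar>x\<bar>\<rceil>" for n
        using that by (auto simp: nat_le_iff ceiling_le_iff split: split_indicator)
      then show "(\<lambda>n. ?g n x) \<longlonglongrightarrow> f x"
        by (intro tendsto_eventually eventually_sequentiallyI)
    qed
    have "(LINT x|lborel. ?g n x) = integral {-real n..real n} f" for n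
      using set_borel_integral_eq_integral(2)[of "{-real n..real n}" f] int
      by (simp add: set_integrable_def set_lebesgue_integral_def)
    then show "(\<lambda>n. LINT x|lborel. ?g n x) \<longlonglongrightarrow> c"
      using pv filterlim_compose[OF _ filterlim_real_sequentially]
      by (auto simp: has_pv_integral_def)
    show "f \<in> borel_measurable lborel"
      using cont by (simp add: borel_measurable_continuous_onI)
  qed (use int nonneg in auto)
qed

text \<open>Let \<open>g\<close> be a primitive of \<open>f\<close> on the half plane. The integral over \<open>[-r, r]\<close> is
  \<open>(g (\<i> r) - g (-\<i> r)) / \<i>\<close>, which is also the integral of \<open>s f(s)\<close> with
  \<open>s = r e\<^sup>\<i>\<^sup>\<theta>\<close> over \<open>\<theta> \<in> [-\<pi>/2, \<pi>/2]\<close>, the right half of the circle of radius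
  \<open>r\<close>. There the integrand is uniformly close to \<open>c\<close> for large \<open>r\<close>.\<close>

lemma has_pv_integral_imaginary_axis:
  fixes f :: "complex \<Rightarrow> complex"
  assumes "0 < e" and holo: "f holomorphic_on {s. Re s > - e}"
    and lim: "((\<lambda>s. s * f s) \<longlongrightarrow> c) at_infinity"
  shows "has_pv_integral (\<lambda>\<omega>. f (\<i> * of_real \<omega>)) (of_real pi * c)"
  unfolding has_pv_integral_def
proof (intro conjI allI)
  let ?H = "{s. Re s > - e}"
  have H: "convex ?H" "open ?H"
    by (simp_all add: convex_halfspace_Re_gt open_halfspace_Re_gt)
  then obtain g where g: "\<And>s. s \<in> ?H \<Longrightarrow> (g has_field_derivative f s) (at s)"
    using holomorphic_convex_primitive'[OF H holo] by (metis at_within_open)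
  show "(\<lambda>\<omega>. f (\<i> * of_real \<omega>)) integrable_on {-r..r}" for r
    using \<open>0 < e\<close>
    by (intro integrable_continuous_real continuous_intros
        continuous_on_compose2[OF holomorphic_on_imp_continuous_on[OF holo]]) auto
  define D where "D r = (g (\<i> * of_real r) - g (- \<i> * of_real r)) / \<i>" for r
  have D: "integral {-r..r} (\<lambda>\<omega>. f (\<i> * of_real \<omega>)) = D r" if "r > 0" for r
  proof -
    have "((\<lambda>\<omega>. g (\<i> * of_real \<omega>) / \<i>) has_vector_derivative f (\<i> * of_real \<omega>)) (at \<omega> within {-r..r})" for \<omega>
      by (rule has_vector_derivative_eq_rhs, rule has_vector_derivative_divide,
          rule field_vector_diff_chain_within[unfolded o_def, OF _ has_field_derivative_at_within[OF g]])
        (use \<open>0 < e\<close> in \<open>auto intro!: derivative_eq_intros\<close>)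
    then have "((\<lambda>\<omega>. f (\<i> * of_real \<omega>)) has_integral
        (g (\<i> * of_real r) / \<i> - g (\<i> * of_real (-r)) / \<i>)) {-r..r}"
      using that by (intro fundamental_theorem_of_calculus) auto
    then show ?thesis
      by (simp add: D_def integral_unique algebra_simps)
  qed
  have "(D \<longlongrightarrow> of_real pi * c) at_top"
  proof (rule tendstoI)
    fix d :: real assume "d > 0"
    \<comment> \<open>The half circle has angular length \<open>\<pi> < 4\<close>.\<close>
    define d' where "d' = d / 4"
    have "d' > 0"
      using \<open>d > 0\<close> by (simp add: d'_def)
    with lim have "\<forall>\<^sub>F s in at_infinity. dist (s * f s) c < d'"
      by (rule tendstoD)
    then obtain b where b: "\<And>s. norm s \<ge> b \<Longrightarrow> norm (s * f s - c) \<le> d'"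
      by (auto simp: eventually_at_infinity dist_norm intro: less_imp_le)
    have "dist (D r) (of_real pi * c) < d" if r: "r \<ge> max 1 b" for r
    proof -
      let ?s = "\<lambda>\<theta>. of_real r * exp (\<i> * of_real \<theta>)"
      have "((\<lambda>\<theta>. g (?s \<theta>) / \<i>) has_vector_derivative ?s \<theta> * f (?s \<theta>)) (at \<theta> within {-(pi/2)..pi/2})"
        if "\<theta> \<in> {-(pi/2)..pi/2}" for \<theta>
      proof -
        have "0 \<le> Re (?s \<theta>)"
          using that r by (simp add: Re_exp cos_ge_zero)
        moreover have "((\<lambda>x. exp (\<i> * of_real x)) has_vector_derivative \<i> * exp (\<i> * of_real \<theta>))
            (at \<theta> within {-(pi/2)..pi/2})"
          by (rule has_vector_derivative_real_field) (auto intro!: derivative_eq_intros)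
        then have "(?s has_vector_derivative of_real r * (\<i> * exp (\<i> * of_real \<theta>)))
            (at \<theta> within {-(pi/2)..pi/2})"
          by (rule has_vector_derivative_mult_right)
        ultimately show ?thesis
          using \<open>0 < e\<close>
          by (intro has_vector_derivative_eq_rhs[OF has_vector_derivative_divide,
                OF field_vector_diff_chain_within[unfolded o_def, OF _ has_field_derivative_at_within[OF g]]])
            (auto simp: algebra_simps)
      qed
      moreover have ends: "?s (pi/2) = \<i> * of_real r" "?s (-(pi/2)) = - \<i> * of_real r"
        unfolding cis_conv_exp[symmetric] by simp_all
      ultimately have "((\<lambda>\<theta>. ?s \<theta> * f (?s \<theta>)) has_integral (g (?s (pi/2)) / \<i> - g (?s (-(pi/2))) / \<i>)) {-(pi/2)..pi/2}"
        by (intro fundamental_theorem_of_calculus) auto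
      also have "g (?s (pi/2)) / \<i> - g (?s (-(pi/2))) / \<i> = D r"
        by (simp only: ends D_def diff_divide_distrib)
      finally have "((\<lambda>\<theta>. ?s \<theta> * f (?s \<theta>)) has_integral D r) {-(pi/2)..pi/2}" .
      from has_integral_diff[OF this has_integral_const_real[of c]]
      have "((\<lambda>\<theta>. ?s \<theta> * f (?s \<theta>) - c) has_integral (D r - of_real pi * c)) {-(pi/2)..pi/2}"
        by (simp add: scaleR_conv_of_real)
      then have "norm (D r - of_real pi * c) \<le> d' * measure lborel (cbox (-(pi/2)) (pi/2))"
        using \<open>d' > 0\<close> r by (intro has_integral_bound[where f = "\<lambda>\<theta>. ?s \<theta> * f (?s \<theta>) - c"]) (auto intro!: b simp: norm_mult)
      also have "\<dots> = d' * pi"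
        by simp
      also have "\<dots> < d"
        using \<open>d > 0\<close> pi_less_4 by (simp add: d'_def)
      finally show ?thesis
        by (simp add: dist_norm)
    qed
    then show "\<forall>\<^sub>F r in at_top. dist (D r) (of_real pi * c) < d"
      by (rule eventually_at_top_linorderI)
  qed
  moreover have "\<forall>\<^sub>F r in at_top. D r = integral {-r..r} (\<lambda>\<omega>. f (\<i> * of_real \<omega>))"
    using eventually_gt_at_top[of "0::real"] by eventually_elim (simp add: D)
  ultimately show "((\<lambda>r. integral {-r..r} (\<lambda>\<omega>. f (\<i> * of_real \<omega>))) \<longlongrightarrow> of_real pi * c) at_top"
    by (rule Lim_transform_eventually)
qed

section \<open>The Lyapunov equation\<close>

text \<open>All eigenvalues of \<open>M\<close> lie in the open left half plane.\<close>

definition hurwitz :: "real^'n^'n \<Rightarrow> bool" where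
  "hurwitz M \<longleftrightarrow> (\<forall>z\<in>eigenvalues M. Re z < 0)"

text \<open>As the spectrum is finite, \<open>Max\<close> bounds the real parts of all eigenvalues.\<close>

lemma hurwitzI: "Max (Re ` eigenvalues M) < 0 \<Longrightarrow> hurwitz M"
  unfolding hurwitz_def
  by (metis Max_ge finite_eigenvalues finite_imageI imageI le_less_trans)

text \<open>Fourier inversion at time \<open>0\<close> for the function that is \<open>0\<close> for \<open>t < 0\<close> and
  \<open>exp (t M)\<close> for \<open>t > 0\<close>: the principal value is \<open>2 \<pi>\<close> times the mean of the one-sided
  limits \<open>0\<close> and \<open>I\<close>.\<close>

lemma has_pv_integral_resolvent:
  assumes "hurwitz M"
  shows "has_pv_integral (\<lambda>\<omega>. resolvent M (\<i> * of_real \<omega>) $ i $ j) (if i = j then of_real pi else 0)"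
proof -
  have "\<exists>e>0. \<forall>z\<in>eigenvalues M. Re z \<le> - e"
  proof (cases "eigenvalues M = {}")
    case False
    then have "Max (Re ` eigenvalues M) < 0"
      using assms finite_eigenvalues[of M] by (simp add: hurwitz_def)
    then show ?thesis
      using finite_eigenvalues[of M] by (intro exI[of _ "- Max (Re ` eigenvalues M)"]) auto
  qed (auto intro: exI[of _ 1])
  then obtain e where e: "e > 0" "\<And>z. z \<in> eigenvalues M \<Longrightarrow> Re z \<le> - e"
    by blast
  have "(\<lambda>s. resolvent M s $ i $ j) holomorphic_on {s. Re s > - e}"
    by (rule holomorphic_on_subset[OF holomorphic_on_resolvent]) (use e(2) in fastforce)
  from has_pv_integral_imaginary_axis[OF e(1) this resolvent_at_infinity]
  show ?thesis
    by (auto split: if_splits)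
qed

lemma matrix_add_rdistrib: "(M + N) ** P = M ** P + N ** P"
  by (simp add: vec_eq_iff matrix_matrix_mult_def sum.distrib distrib_right)

lemma matrix_mult_scaleR:
  fixes M :: "real^'n^'m"
  shows "M ** (c *\<^sub>R N) = c *\<^sub>R (M ** N)" "(c *\<^sub>R M) ** P = c *\<^sub>R (M ** P)"
  by (simp_all add: vec_eq_iff matrix_matrix_mult_def sum_distrib_left mult_ac)

lemma conj_transpose_mult: "conj_transpose (M ** N) = conj_transpose N ** conj_transpose M"
  by (simp add: conj_transpose_def matrix_matrix_mult_def vec_eq_iff mult.commute)

lemma conj_transpose_cmat: "conj_transpose (cmat M) = cmat (transpose M)"
  by (simp add: conj_transpose_def transpose_def vec_eq_iff)

lemma cmat_mult: "cmat (M ** N) = cmat M ** cmat N"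
  by (simp add: matrix_matrix_mult_def vec_eq_iff)

lemma cmat_add: "cmat (M + N) = cmat M + cmat N"
  by (simp add: vec_eq_iff)

text \<open>With \<open>D = s I - M\<close>, so that \<open>F D = I\<close> for the resolvent \<open>F\<close>, the Lyapunov equation
  reads \<open>W = D X + X D\<^sup>H\<close> on the imaginary axis, because \<open>s + cnj s = 0\<close> there.
  Multiplying by \<open>F\<close> and \<open>F\<^sup>H\<close> turns the quadratic expression \<open>F W F\<^sup>H\<close> into one that is
  linear in \<open>F\<close>.\<close>

lemma resolvent_lyapunov:
  fixes M X W :: "real^'n^'n"
  assumes lyap: "M ** X + X ** transpose M + W = 0" and s: "Re s = 0" "s \<notin> eigenvalues M"
  shows "resolvent M s ** cmat W ** conj_transpose (resolvent M s) =
    cmat X ** conj_transpose (resolvent M s) + resolvent M s ** cmat X"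
proof -
  define F where "F = resolvent M s"
  define D where "D = mat s - cmat M"
  have FD: "F ** D = mat 1"
    using resolvent_inverse[OF s(2)] by (simp add: F_def D_def)
  have "conj_transpose D ** conj_transpose F = conj_transpose (mat 1)"
    using FD by (simp add: conj_transpose_mult[symmetric])
  also have "conj_transpose (mat 1) = (mat 1 :: complex^'n^'n)"
    by (simp add: conj_transpose_def mat_def vec_eq_iff)
  finally have DF: "conj_transpose D ** conj_transpose F = mat 1" .
  have "cnj s = - s"
    using s(1) by (simp add: complex_eq_iff)
  have "D + cmat M = mat s" "conj_transpose D + cmat (transpose M) = mat (- s)"
    by (simp_all add: D_def conj_transpose_def transpose_def vec_eq_iff mat_def \<open>cnj s = - s\<close>)
  then have "(D + cmat M) ** cmat X + cmat X ** (conj_transpose D + cmat (transpose M)) =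
      mat s ** cmat X + cmat X ** mat (- s)"
    by simp
  also have "\<dots> = 0"
    by (simp add: vec_eq_iff matrix_matrix_mult_def mat_def if_distrib if_distribR cong: if_cong)
  finally have "D ** cmat X + cmat X ** conj_transpose D +
      (cmat M ** cmat X + cmat X ** cmat (transpose M)) = 0"
    by (simp add: matrix_add_ldistrib matrix_add_rdistrib algebra_simps)
  moreover have "cmat M ** cmat X + cmat X ** cmat (transpose M) + cmat W = 0"
    using arg_cong[OF lyap, of cmat] by (simp add: cmat_mult cmat_add) (simp add: vec_eq_iff)
  ultimately have "cmat W = D ** cmat X + cmat X ** conj_transpose D"
    by (metis add_right_imp_eq add.commute)
  then have "F ** cmat W ** conj_transpose F =
      F ** D ** cmat X ** conj_transpose F + F ** cmat X ** (conj_transpose D ** conj_transpose F)"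
    by (simp add: matrix_add_ldistrib matrix_add_rdistrib matrix_mul_assoc)
  then show ?thesis
    unfolding F_def[symmetric] by (simp add: FD DF)
qed

lemma hurwitz_imaginary_axis:
  assumes "hurwitz M" shows "\<i> * of_real \<omega> \<notin> eigenvalues M"
  using assms by (force simp: hurwitz_def)

text \<open>A solution of the Lyapunov equation is the controllability Gramian in the frequency
  domain.\<close>

lemma has_pv_integral_lyapunov:
  fixes M X W :: "real^'n^'n"
  assumes "hurwitz M" and lyap: "M ** X + X ** transpose M + W = 0"
  shows "has_pv_integral (\<lambda>\<omega>. (resolvent M (\<i> * of_real \<omega>) ** cmat W **
    conj_transpose (resolvent M (\<i> * of_real \<omega>))) $ i $ j) (of_real (2 * pi * X $ i $ j))"
proof -
  let ?F = "\<lambda>\<omega>. resolvent M (\<i> * of_real \<omega>)"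
  have gram: "?F \<omega> ** cmat W ** conj_transpose (?F \<omega>) =
      cmat X ** conj_transpose (?F \<omega>) + ?F \<omega> ** cmat X" for \<omega>
    by (rule resolvent_lyapunov[OF lyap]) (simp_all add: hurwitz_imaginary_axis[OF assms(1)])
  have "has_pv_integral (\<lambda>\<omega>. (\<Sum>k\<in>UNIV. of_real (X $ i $ k) * cnj (?F \<omega> $ j $ k)) +
      (\<Sum>k\<in>UNIV. ?F \<omega> $ i $ k * of_real (X $ k $ j)))
    ((\<Sum>k\<in>UNIV. of_real (X $ i $ k) * cnj (if j = k then of_real pi else 0 :: complex)) +
      (\<Sum>k\<in>UNIV. (if i = k then of_real pi else 0 :: complex) * of_real (X $ k $ j)))"
    by (intro has_pv_integral_add has_pv_integral_sum
        has_pv_integral_linear[where h = "\<lambda>x. of_real _ * cnj x"]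
        has_pv_integral_linear[where h = "\<lambda>x. x * of_real _"] has_pv_integral_resolvent assms
        bounded_linear_mult_left bounded_linear_compose[OF bounded_linear_mult_right bounded_linear_cnj])
  also have "(\<lambda>\<omega>. (\<Sum>k\<in>UNIV. of_real (X $ i $ k) * cnj (?F \<omega> $ j $ k)) +
      (\<Sum>k\<in>UNIV. ?F \<omega> $ i $ k * of_real (X $ k $ j))) =
      (\<lambda>\<omega>. (?F \<omega> ** cmat W ** conj_transpose (?F \<omega>)) $ i $ j)"
    unfolding gram by (simp add: matrix_matrix_mult_def conj_transpose_def)
  also have "(\<Sum>k\<in>UNIV. of_real (X $ i $ k) * cnj (if j = k then of_real pi else 0 :: complex)) +
      (\<Sum>k\<in>UNIV. (if i = k then of_real pi else 0 :: complex) * of_real (X $ k $ j)) =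
      (of_real (2 * pi * X $ i $ j) :: complex)"
    by (simp add: if_distrib if_distribR cong: if_cong)
  finally show ?thesis .
qed

text \<open>For \<open>W = 0\<close> the integrand of the Gramian vanishes, hence so does \<open>X\<close>.\<close>

lemma lyapunov_homogeneous:
  fixes M X :: "real^'n^'n"
  assumes "hurwitz M" "M ** X + X ** transpose M = 0"
  shows "X = 0"
proof -
  have cmat0: "cmat (0 :: real^'n^'n) = 0"
    by (simp add: vec_eq_iff)
  have "of_real (2 * pi * X $ i $ j) = (0 :: complex)" for i j
  proof (rule has_pv_integral_unique)
    show "has_pv_integral (\<lambda>\<omega>. (resolvent M (\<i> * of_real \<omega>) ** cmat 0 **
        conj_transpose (resolvent M (\<i> * of_real \<omega>))) $ i $ j) (of_real (2 * pi * X $ i $ j))"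
      using assms by (intro has_pv_integral_lyapunov) simp_all
  qed (simp add: cmat0 has_pv_integral_0)
  then show ?thesis
    by (simp add: vec_eq_iff)
qed

text \<open>The Lyapunov operator is an injective linear map of a finite-dimensional space to itself.\<close>

lemma lyapunov_solvable:
  fixes M W :: "real^'n^'n"
  assumes "hurwitz M"
  obtains X where "M ** X + X ** transpose M + W = 0"
proof -
  let ?L = "\<lambda>X. M ** X + X ** transpose M"
  have lin: "linear ?L"
    by (rule linearI) (simp_all add: matrix_add_ldistrib matrix_add_rdistrib
        matrix_mult_scaleR scaleR_add_right add_ac)
  have "inj ?L"
    unfolding linear_injective_0[OF lin] using lyapunov_homogeneous[OF assms] by blast
  then have "surj ?L"
    using lin linear_injective_imp_surjective by blast
  then obtain X where "- W = ?L X"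
    by (rule surjE)
  from this[symmetric] show thesis
    by (intro that[of X]) simp
qed

lemma Re_trace_conj_transpose_mult:
  "Re (trace (conj_transpose T ** T)) = (\<Sum>j\<in>UNIV. \<Sum>i\<in>UNIV. (norm (T $ i $ j))\<^sup>2)"
  unfolding trace_def matrix_matrix_mult_def conj_transpose_def
  by (simp add: complex_norm_square[symmetric] mult.commute[of "cnj _"] cmod_power2 power2_eq_square)

text \<open>The case \<open>C = v\<^sup>T\<close> gives the quadratic form of \<open>X\<close>, and the output matrix of the
  closed loop gives the \<open>H\<^sub>2\<close> norm.\<close>

lemma has_pv_integral_energy:
  fixes M X V :: "real^'n^'n" and C :: "real^'n^'p"
  assumes "hurwitz M" and lyap: "M ** X + X ** transpose M + V ** transpose V = 0"
  defines "T \<equiv> \<lambda>s. cmat C ** resolvent M s ** cmat V"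
  shows "has_pv_integral (\<lambda>\<omega>. Re (trace (conj_transpose (T (\<i> * of_real \<omega>)) ** T (\<i> * of_real \<omega>))))
    (2 * pi * trace (transpose C ** C ** X))"
proof -
  define P where "P = transpose C ** C"
  define G where "G s = resolvent M s ** cmat (V ** transpose V) ** conj_transpose (resolvent M s)" for s
  have trace_T: "trace (conj_transpose (T s) ** T s) = (\<Sum>i\<in>UNIV. \<Sum>k\<in>UNIV. of_real (P $ i $ k) * G s $ k $ i)" for s
  proof -
    have "trace (conj_transpose (T s) ** T s) = trace (T s ** conj_transpose (T s))"
      by (rule trace_mul_sym)
    also have "T s ** conj_transpose (T s) = cmat C ** (G s ** cmat (transpose C))"
      by (simp add: T_def G_def conj_transpose_mult conj_transpose_cmat cmat_mult matrix_mul_assoc)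
    also have "trace \<dots> = trace (G s ** cmat (transpose C) ** cmat C)"
      by (rule trace_mul_sym)
    also have "\<dots> = trace (cmat P ** G s)"
      by (simp add: P_def cmat_mult matrix_mul_assoc[symmetric] trace_mul_sym[of "G s"])
    finally show ?thesis
      by (simp add: trace_def matrix_matrix_mult_def)
  qed
  have "has_pv_integral (\<lambda>\<omega>. Re (\<Sum>i\<in>UNIV. \<Sum>k\<in>UNIV. of_real (P $ i $ k) * G (\<i> * of_real \<omega>) $ k $ i))
      (Re (\<Sum>i\<in>UNIV. \<Sum>k\<in>UNIV. of_real (P $ i $ k) * of_real (2 * pi * X $ k $ i)))"
    unfolding G_def
    by (intro has_pv_integral_linear[OF _ bounded_linear_Re] has_pv_integral_sum
        has_pv_integral_linear[OF _ bounded_linear_mult_right] has_pv_integral_lyapunov assms)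
  also have "Re (\<Sum>i\<in>UNIV. \<Sum>k\<in>UNIV. of_real (P $ i $ k) * of_real (2 * pi * X $ k $ i)) =
      2 * pi * trace (P ** X)"
    by (simp add: trace_def matrix_matrix_mult_def sum_distrib_left mult_ac)
  finally show ?thesis
    by (simp add: trace_T P_def)
qed

text \<open>The solution is symmetric because its transpose is also a solution, and its quadratic form
  is nonnegative as the integral of a nonnegative function. If the form vanishes at \<open>v\<close>, then
  \<open>X v = 0\<close>, and evaluating the Lyapunov equation at \<open>v\<close> gives \<open>v\<^sup>T V V\<^sup>T v = 0\<close>.\<close>

lemma lyapunov_solution_pos_def:
  fixes M X V :: "real^'n^'n"
  assumes "hurwitz M" and lyap: "M ** X + X ** transpose M + V ** transpose V = 0"
    and W: "pos_def (V ** transpose V)"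
  shows "pos_def X"
proof -
  let ?W = "V ** transpose V"
  have "transpose (M ** X + X ** transpose M + ?W) = transpose X ** transpose M + M ** transpose X + ?W"
    by (simp add: transpose_def vec_eq_iff matrix_matrix_mult_def mult.commute)
  then have tr: "M ** transpose X + transpose X ** transpose M + ?W = 0"
    using lyap by (simp add: transpose_def vec_eq_iff add.commute)
  have "M ** (transpose X - X) + (transpose X - X) ** transpose M = 0"
  proof -
    have "M ** (transpose X - X) = M ** transpose X - M ** X"
      "(transpose X - X) ** transpose M = transpose X ** transpose M - X ** transpose M"
      by (simp_all add: eq_diff_eq matrix_add_ldistrib[symmetric] matrix_add_rdistrib[symmetric])
    then have "M ** (transpose X - X) + (transpose X - X) ** transpose M =
        (M ** transpose X + transpose X ** transpose M + ?W) - (M ** X + X ** transpose M + ?W)"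
      by simp
    then show ?thesis
      unfolding lyap tr by simp
  qed
  then have "transpose X - X = 0"
    by (rule lyapunov_homogeneous[OF assms(1)])
  then have sym: "symmetric X"
    by (simp add: symmetric_def)
  have nonneg: "0 \<le> v \<bullet> (X *v v)" for v
  proof -
    let ?C = "rowvector v :: real^'n^1"
    have "0 \<le> 2 * pi * trace (transpose ?C ** ?C ** X)"
      by (rule has_pv_integral_nonneg[OF has_pv_integral_energy[OF assms(1) lyap]])
        (simp add: Re_trace_conj_transpose_mult sum_nonneg)
    also have "trace (transpose ?C ** ?C ** X) = v \<bullet> (X *v v)"
      by (simp add: trace_def transpose_def rowvector_def matrix_matrix_mult_def
          matrix_vector_mult_def inner_vec_def sum_distrib_left mult_ac) (subst sum.swap, simp add: mult_ac)
    finally show ?thesis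
      using pi_gt_zero by (auto simp: zero_le_mult_iff dest: leD)
  qed
  show ?thesis
    unfolding pos_def_def
  proof (intro conjI sym allI impI)
    fix v :: "real^'n" assume "v \<noteq> 0"
    show "0 < v \<bullet> (X *v v)"
    proof (rule ccontr)
      assume "\<not> 0 < v \<bullet> (X *v v)"
      then have 0: "v \<bullet> (X *v v) = 0"
        using nonneg[of v] by simp
      have psd: "pos_semidef X"
        using sym nonneg by (simp add: pos_semidef_def)
      have "v \<bullet> (X *v v) = v \<bullet> (mat_sqrt X *v (mat_sqrt X *v v))"
        by (simp add: matrix_vector_mul_assoc mat_sqrt_properties[OF psd])
      also have "\<dots> = (mat_sqrt X *v v) \<bullet> (mat_sqrt X *v v)"
        by (rule symmetric_inner_matrix_vector) (simp add: symmetric_def mat_sqrt_properties[OF psd])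
      finally have "mat_sqrt X *v v = 0"
        using 0 by simp
      then have Xv: "X *v v = 0"
        by (metis mat_sqrt_properties(2)[OF psd] matrix_vector_mul_assoc matrix_vector_mult_0_right)
      have "0 = v \<bullet> ((M ** X + X ** transpose M + ?W) *v v)"
        by (simp add: lyap)
      also have "\<dots> = v \<bullet> (M *v (X *v v)) + v \<bullet> (X *v (transpose M *v v)) + v \<bullet> (?W *v v)"
        by (simp add: matrix_vector_mult_add_rdistrib inner_add_right matrix_vector_mul_assoc
            del: transpose_matrix_vector)
      also have "\<dots> = v \<bullet> (?W *v v)"
        by (simp add: Xv symmetric_inner_matrix_vector[OF sym, of v "transpose M *v v"]
            del: transpose_matrix_vector)
      finally show False
        using W \<open>v \<noteq> 0\<close> by (auto simp: pos_def_def)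
    qed
  qed
qed

section \<open>The closed-loop transfer function\<close>

lemma continuous_on_resolvent_imaginary_axis:
  assumes "hurwitz M"
  shows "continuous_on UNIV (\<lambda>\<omega>. resolvent M (\<i> * of_real \<omega>) $ i $ j)"
  by (rule continuous_on_compose2[OF holomorphic_on_imp_continuous_on[OF holomorphic_on_resolvent[of M]]])
    (auto intro!: continuous_intros simp: hurwitz_imaginary_axis[OF assms])

lemma h2_norm_squared:
  fixes M X V :: "real^'n^'n" and C :: "real^'n^'p"
  assumes "hurwitz M" and lyap: "M ** X + X ** transpose M + V ** transpose V = 0"
  shows "(h2_norm (\<lambda>s. cmat C ** resolvent M s ** cmat V))\<^sup>2 = trace (transpose C ** C ** X)"
proof -
  let ?T = "\<lambda>\<omega>. cmat C ** resolvent M (\<i> * of_real \<omega>) ** cmat V"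
  let ?f = "\<lambda>\<omega>. Re (trace (conj_transpose (?T \<omega>) ** ?T \<omega>))"
  have pv: "has_pv_integral ?f (2 * pi * trace (transpose C ** C ** X))"
    by (rule has_pv_integral_energy[OF assms])
  have nonneg: "0 \<le> ?f \<omega>" for \<omega>
    by (simp add: Re_trace_conj_transpose_mult sum_nonneg)
  have "continuous_on UNIV (\<lambda>\<omega>. ?T \<omega> $ i $ j)" for i j
    by (simp add: matrix_matrix_mult_def)
      (intro continuous_intros continuous_on_resolvent_imaginary_axis assms)
  then have "continuous_on UNIV ?f"
    unfolding Re_trace_conj_transpose_mult
    by (intro continuous_on_sum continuous_on_power continuous_on_norm)
  then have "(LINT \<omega>|lborel. ?f \<omega>) = 2 * pi * trace (transpose C ** C ** X)"
    by (rule lebesgue_integral_eq_pv_integral[OF pv nonneg])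
  moreover have "0 \<le> 2 * pi * trace (transpose C ** C ** X)"
    by (rule has_pv_integral_nonneg[OF pv nonneg])
  then have "0 \<le> trace (transpose C ** C ** X)"
    using pi_gt_zero by (auto simp: zero_le_mult_iff dest: leD)
  ultimately show ?thesis
    by (simp add: h2_norm_def)
qed

lemma transpose_mult_vstack:
  "transpose (vstack M N) ** vstack M N = transpose M ** M + transpose N ** (N :: real^'n^'q)"
  by (simp add: vec_eq_iff matrix_matrix_mult_def transpose_def vstack_def
      UNIV_Plus_UNIV[symmetric] sum.Plus del: UNIV_Plus_UNIV)

theorem proposition4p1:
  fixes A :: "real^'n^'n" and B :: "real^'m^'n" and Bw W Q :: "real^'n^'n" and R :: "real^'m^'m"
  assumes "W = Bw ** transpose Bw"
    and "controllable A B" and "observable (mat_sqrt Q) A"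
    and "pos_def W" and "pos_semidef Q" and "pos_def R"
  shows "\<forall>K\<in>stabilizing A B.
    non_degenerate (ecl_LQR A B W Q R) (J_LQR A B Bw Q R) K"
proof
  fix K assume K: "K \<in> stabilizing A B"
  define M where "M = A + B ** K"
  define C where "C = vstack (mat_sqrt Q) (mat_sqrt R ** K)"
  have M: "hurwitz M"
    using K by (simp add: stabilizing_def M_def hurwitzI)
  obtain X where lyap: "M ** X + X ** transpose M + Bw ** transpose Bw = 0"
    using lyapunov_solvable[OF M] by blast
  have X: "pos_def X"
    using lyapunov_solution_pos_def[OF M lyap] assms by simp
  have "pos_semidef R"
    using assms(6) by (auto simp: pos_def_def pos_semidef_def)
      (metis inner_zero_left less_eq_real_def)
  then have C: "transpose C ** C = Q + transpose K ** R ** K"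
    using mat_sqrt_properties[OF assms(5)] mat_sqrt_properties[of R]
    by (simp add: C_def transpose_mult_vstack matrix_transpose_mul)
      (metis matrix_mul_assoc)
  have "transfer_zw A B Bw Q R K = (\<lambda>s. cmat C ** resolvent M s ** cmat Bw)"
    by (simp add: fun_eq_iff transfer_zw_def resolvent_def C_def M_def cmat_add diff_diff_add)
  then have "J_LQR A B Bw Q R K = trace ((Q + transpose K ** R ** K) ** X)"
    by (simp add: J_LQR_def h2_norm_squared[OF M lyap] C)
  then have "(K, J_LQR A B Bw Q R K, X) \<in> L_LQR A B W Q R"
    using X lyap assms(1) by (simp add: L_LQR_def M_def)
  then show "non_degenerate (ecl_LQR A B W Q R) (J_LQR A B Bw Q R) K"
    by (force simp: non_degenerate_def ecl_LQR_def)
qed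

end
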